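(* Let $f\in Z^2(G,S^* )$. Then the function $$r_f:G\to\mathbb{N},\qquad r_f(\sigma)=v_{\pi}(f(\sigma,\sigma^{-1})),$$ is an element of $Sl(G)$ with $M_{r_f}=H(f)$.
   Context: Standing assumptions: $R$ is a complete discrete valuation ring with quotient field $K$, $L$ is a finite Galois extension of $K$ with Galois group $G$, unramified with finite residue field; $S$ is the integral closure of $R$ in $L$, $\pi S$ its unique maximal ideal (with $\pi$ a fixed generator), $S^*=S\setminus\{0\}$, and $U(S)$ the group of units of $S$. $v_\pi$ is the $\pi S$-adic valuation, $v_\pi(s)=\max\{z\in\mathbb{Z}: s\in\pi^zS\}$ for $s\neq 0$. For $\sigma\in G$ and $l\in L$ write $l^\sigma=\sigma(l)$. $Z^2(G,S^* )$ is the set of normalized weak $2$-cocycles of $G$ on $S^*$, i.e. functions $f:G\times G\to S^*$ with $f(\sigma,\tau)f(\sigma\tau,\rho)=f(\tau,\rho)^{\sigma}f(\sigma,\tau\rho)$ for all $\sigma,\tau,\rho\in G$ and $f(1,\sigma)=f(\sigma,1)=1$ for all $\sigma\in G$. The inertial group of $f\in Z^2(G,S^* )$ is $H(f)=\{\sigma\in G: f(\sigma,\sigma^{-1})\in U(S)\}$. $Sl(G)$ is the set of all functions $r:G\to\mathbb{N}$ (with $0\in\mathbb{N}$) satisfying $r(1)=0$ and $r(\sigma\tau)\leq r(\sigma)+r(\tau)$ for all $\sigma,\tau\in G$. For $r\in Sl(G)$, $M_r=\{\sigma\in G: r(\sigma)=0\}$. *)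

theory Defs
  imports "HOL-Algebra.Algebra"
begin

definition discrete_valuation_ring :: "('a, 'b) ring_scheme \<Rightarrow> bool" where
  "discrete_valuation_ring R \<longleftrightarrow>
     principal_domain R \<and> \<not> field R \<and> (\<exists>!m. maximalideal m R)"

text \<open>Powers of an ideal are taken in \<^const>\<open>ideals_set\<close>, where multiplication is
  the ideal product. As in Bourbaki, completeness includes separatedness, which is automatic
  for a discrete valuation ring.\<close>

definition adically_complete :: "('a, 'b) ring_scheme \<Rightarrow> 'a set \<Rightarrow> bool" where
  "adically_complete R I \<longleftrightarrow>
     (\<Inter>k::nat. I [^]\<^bsub>ideals_set R\<^esub> k) = {\<zero>\<^bsub>R\<^esub>} \<and>
     (\<forall>x :: nat \<Rightarrow> 'a.
        (\<forall>n. x n \<in> carrier R) \<and>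
        (\<forall>k::nat. \<exists>N. \<forall>i\<ge>N. \<forall>j\<ge>N. x i \<ominus>\<^bsub>R\<^esub> x j \<in> I [^]\<^bsub>ideals_set R\<^esub> k) \<longrightarrow>
        (\<exists>y\<in>carrier R. \<forall>k::nat. \<exists>N. \<forall>i\<ge>N. x i \<ominus>\<^bsub>R\<^esub> y \<in> I [^]\<^bsub>ideals_set R\<^esub> k))"

text \<open>The subset \<open>K\<close> of the field \<open>L\<close> is the quotient field of the subring \<open>R\<close>.\<close>

definition quotient_field_in :: "('a, 'b) ring_scheme \<Rightarrow> 'a set \<Rightarrow> 'a set \<Rightarrow> bool" where
  "quotient_field_in L R K \<longleftrightarrow>
     subfield K L \<and> K = {a \<otimes>\<^bsub>L\<^esub> inv\<^bsub>L\<^esub> b | a b. a \<in> R \<and> b \<in> R - {\<zero>\<^bsub>L\<^esub>}}"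

text \<open>The group \<open>Gal(L/K)\<close>. As for \<^const>\<open>AutoGroup\<close>, its elements are extensional functions
  and its multiplication is composition, \<open>(\<sigma>\<tau>)(x) = \<sigma>(\<tau>(x))\<close>.\<close>

definition galois_group :: "('a, 'b) ring_scheme \<Rightarrow> 'a set \<Rightarrow> ('a \<Rightarrow> 'a) monoid" where
  "galois_group L K = BijGroup (carrier L)
     \<lparr>carrier := {\<sigma> \<in> ring_hom L L \<inter> Bij (carrier L). \<forall>x\<in>K. \<sigma> x = x}\<rparr>"

definition finite_galois_extension :: "('a, 'b) ring_scheme \<Rightarrow> 'a set \<Rightarrow> bool" where
  "finite_galois_extension L K \<longleftrightarrow>
     field L \<and> subfield K L \<and> ring.finite_dimension L K (carrier L) \<and>
     {x \<in> carrier L. \<forall>\<sigma>\<in>carrier (galois_group L K). \<sigma> x = x} = K"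

definition integral_closure :: "('a, 'b) ring_scheme \<Rightarrow> 'a set \<Rightarrow> 'a set" where
  "integral_closure L R =
     {x \<in> carrier L. \<exists>p. polynomial\<^bsub>L\<^esub> R p \<and> p \<noteq> [] \<and> lead_coeff p = \<one>\<^bsub>L\<^esub> \<and> ring.eval L p x = \<zero>\<^bsub>L\<^esub>}"

text \<open>Formal derivative of a coefficient list (leading coefficient first): position \<open>i\<close> of \<open>p\<close>
  holds the coefficient of \<open>X\<close> to the power \<open>degree p - i\<close>.\<close>

definition formal_deriv :: "('a, 'b) ring_scheme \<Rightarrow> 'a list \<Rightarrow> 'a list" where
  "formal_deriv R p =
     ring.normalize R (map (\<lambda>i. [(degree p - i)] \<cdot>\<^bsub>R\<^esub> (p ! i)) [0..<degree p])"

text \<open>Every element of \<open>E\<close> is algebraic over the subfield \<open>k\<close>, with a minimal polynomial coprime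
  to its derivative.\<close>

definition separable_extension :: "('a, 'b) ring_scheme \<Rightarrow> 'a set \<Rightarrow> bool" where
  "separable_extension E k \<longleftrightarrow>
     (\<forall>x\<in>carrier E. \<not> ring.transcendental E k x \<and>
        Idl\<^bsub>univ_poly E k\<^esub> {ring.Irr E k x, formal_deriv E (ring.Irr E k x)} = carrier (univ_poly E k))"

text \<open>For rings \<open>R \<subseteq> S\<close>, where \<open>S\<close> is local and \<open>m\<close> is the maximal ideal of \<open>R\<close>:
  \<open>m S\<close> is the maximal ideal of \<open>S\<close> (ramification index 1), and the residue field extension
  is separable.\<close>

definition unramified :: "('a, 'b) ring_scheme \<Rightarrow> 'a set \<Rightarrow> 'a set \<Rightarrow> bool" where
  "unramified S R m \<longleftrightarrow>
     maximalideal (Idl\<^bsub>S\<^esub> m) S \<and>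
     separable_extension (S Quot (Idl\<^bsub>S\<^esub> m)) ((\<lambda>a. (Idl\<^bsub>S\<^esub> m) +>\<^bsub>S\<^esub> a) ` R)"

text \<open>The exponent \<open>z\<close> ranges over the integers, and the powers of \<open>\<pi>\<close> are taken in the
  field \<open>L\<close>. The value is meaningful for nonzero \<open>s\<close> only.\<close>

definition adic_valuation :: "('a, 'b) ring_scheme \<Rightarrow> 'a set \<Rightarrow> 'a \<Rightarrow> 'a \<Rightarrow> int" where
  "adic_valuation L S \<pi> s = (GREATEST z::int. s \<in> {(\<pi> [^]\<^bsub>L\<^esub> z) \<otimes>\<^bsub>L\<^esub> t | t. t \<in> S})"

text \<open>Normalized weak 2-cocycles of a group \<open>G\<close> of functions on \<open>L\<close>, with values in
  the nonzero elements of \<open>S \<subseteq> L\<close>. Cocycles are curried, and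
  their values outside \<open>carrier G\<close> are irrelevant.\<close>

definition weak_cocycles ::
    "('a, 'b) ring_scheme \<Rightarrow> 'a set \<Rightarrow> ('a \<Rightarrow> 'a) monoid \<Rightarrow> (('a \<Rightarrow> 'a) \<Rightarrow> ('a \<Rightarrow> 'a) \<Rightarrow> 'a) set" where
  "weak_cocycles L S G =
     {f. (\<forall>\<sigma>\<in>carrier G. \<forall>\<tau>\<in>carrier G. f \<sigma> \<tau> \<in> S - {\<zero>\<^bsub>L\<^esub>}) \<and>
         (\<forall>\<sigma>\<in>carrier G. \<forall>\<tau>\<in>carrier G. \<forall>\<rho>\<in>carrier G.
            f \<sigma> \<tau> \<otimes>\<^bsub>L\<^esub> f (\<sigma> \<otimes>\<^bsub>G\<^esub> \<tau>) \<rho> = \<sigma> (f \<tau> \<rho>) \<otimes>\<^bsub>L\<^esub> f \<sigma> (\<tau> \<otimes>\<^bsub>G\<^esub> \<rho>)) \<and>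
         (\<forall>\<sigma>\<in>carrier G. f \<one>\<^bsub>G\<^esub> \<sigma> = \<one>\<^bsub>L\<^esub> \<and> f \<sigma> \<one>\<^bsub>G\<^esub> = \<one>\<^bsub>L\<^esub>)}"

definition inertial_group ::
    "('a, 'b) ring_scheme \<Rightarrow> 'a set \<Rightarrow> ('a \<Rightarrow> 'a) monoid \<Rightarrow> (('a \<Rightarrow> 'a) \<Rightarrow> ('a \<Rightarrow> 'a) \<Rightarrow> 'a) \<Rightarrow> ('a \<Rightarrow> 'a) set" where
  "inertial_group L S G f = {\<sigma> \<in> carrier G. f \<sigma> (inv\<^bsub>G\<^esub> \<sigma>) \<in> Units (L\<lparr>carrier := S\<rparr>)}"

definition Sl :: "('g, 'b) monoid_scheme \<Rightarrow> ('g \<Rightarrow> nat) set" where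
  "Sl G = {r. r \<one>\<^bsub>G\<^esub> = 0 \<and>
     (\<forall>\<sigma>\<in>carrier G. \<forall>\<tau>\<in>carrier G. r (\<sigma> \<otimes>\<^bsub>G\<^esub> \<tau>) \<le> r \<sigma> + r \<tau>)}"

definition Sl_kernel :: "('g, 'b) monoid_scheme \<Rightarrow> ('g \<Rightarrow> nat) \<Rightarrow> 'g set" where
  "Sl_kernel G r = {\<sigma> \<in> carrier G. r \<sigma> = 0}"

text \<open>The function \<open>r\<^sub>f\<close>. The valuation is an integer, so a statement about \<open>r\<^sub>f\<close> should also say
  that it is nonnegative on the values of \<open>f\<close>.\<close>

definition cocycle_val ::
    "('a, 'b) ring_scheme \<Rightarrow> 'a set \<Rightarrow> ('a \<Rightarrow> 'a) monoid \<Rightarrow> 'a \<Rightarrow> (('a \<Rightarrow> 'a) \<Rightarrow> ('a \<Rightarrow> 'a) \<Rightarrow> 'a) \<Rightarrow> ('a \<Rightarrow> 'a) \<Rightarrow> nat" where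
  "cocycle_val L S G \<pi> f \<sigma> = nat (adic_valuation L S \<pi> (f \<sigma> (inv\<^bsub>G\<^esub> \<sigma>)))"

end

theory Submission
  imports Defs
begin

text \<open>The ring \<open>S\<close> is local, so a nonzero \<open>s \<in> S\<close> is a unit times a power of \<open>\<pi>\<close> as soon as some
  power of \<open>\<pi>\<close> does not divide it. Such a power exists because \<open>s\<close> divides the lowest nonzero
  coefficient \<open>a \<in> R\<close> of an integral equation for \<open>s\<close>, the powers of the maximal ideal of \<open>R\<close>
  intersect in zero, and \<open>\<pi>\<close> is associated in \<open>S\<close> to a uniformizer of \<open>R\<close>. Hence the valuation \<open>v\<close> is additive, and \<open>G\<close>-invariant since \<open>G\<close> fixes \<open>R\<close>. Write
  \<open>\<rho> = (\<sigma>\<tau>)\<^sup>-\<^sup>1\<close>. The cocycle identity for \<open>(\<sigma>, \<tau>, \<rho>)\<close> gives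
  \<open>v(f(\<sigma>\<tau>, \<rho>)) \<le> v(f(\<tau>, \<rho>)) + v(f(\<sigma>, \<sigma>\<^sup>-\<^sup>1))\<close>, and the one for \<open>(\<tau>, \<tau>\<^sup>-\<^sup>1, \<sigma>\<^sup>-\<^sup>1)\<close> gives
  \<open>v(f(\<tau>, \<rho>)) \<le> v(f(\<tau>, \<tau>\<^sup>-\<^sup>1))\<close>.\<close>

section \<open>Maximal ideals and factorization in local rings\<close>

text \<open>Zorn's lemma for the ideals above \<open>I\<close> that avoid \<one>: the union of a
  chain of them avoids \<one> too, and an ideal containing \<one> is the whole ring.\<close>

lemma (in ring) maximalideal_exists:
  assumes "ideal I R" and "\<one> \<notin> I"
  shows "\<exists>M. maximalideal M R \<and> I \<subseteq> M"
proof -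
  define A where "A = {J. ideal J R \<and> I \<subseteq> J \<and> \<one> \<notin> J}"
  have "\<exists>M\<in>A. \<forall>J\<in>A. M \<subseteq> J \<longrightarrow> J = M"
  proof (rule subset_Zorn_nonempty)
    show "A \<noteq> {}" using assms by (auto simp: A_def)
  next
    fix C assume C: "C \<noteq> {}" "subset.chain A C"
    have "C \<subseteq> A" and "subset.chain {J. ideal J R} C"
      using C(2) by (auto simp: pred_on.chain_def A_def)
    then have "ideal (\<Union>C) R"
      using chain_Union_is_ideal[of C] C(1) by simp
    then show "\<Union>C \<in> A"
      using \<open>C \<subseteq> A\<close> C(1) by (fastforce simp: A_def)
  qed
  then obtain M where M: "M \<in> A" and max: "\<And>J. J \<in> A \<Longrightarrow> M \<subseteq> J \<Longrightarrow> J = M"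
    by blast
  have "maximalideal M R"
  proof (rule maximalidealI)
    show "ideal M R" using M by (simp add: A_def)
    show "carrier R \<noteq> M" using M by (auto simp: A_def)
  next
    fix J assume J: "ideal J R" "M \<subseteq> J" "J \<subseteq> carrier R"
    show "J = M \<or> J = carrier R"
      using max[of J] M J ideal.one_imp_carrier[OF J(1)] by (auto simp: A_def)
  qed
  then show ?thesis using M by (auto simp: A_def)
qed

text \<open>A non-unit generates a proper ideal, which lies in some maximal ideal and hence in
  \<open>M\<close>.\<close>

lemma (in cring) mem_Units_of_unique_maximalideal:
  assumes "{J. maximalideal J R} = {M}" and s: "s \<in> carrier R" "s \<notin> M"
  shows "s \<in> Units R"
proof (rule ccontr)
  assume "s \<notin> Units R"
  have "\<one> \<notin> PIdl s"
    using \<open>s \<notin> Units R\<close> s(1) m_comm by (force simp: cgenideal_def Units_def)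
  then obtain J where "maximalideal J R" "PIdl s \<subseteq> J"
    using maximalideal_exists[OF cgenideal_ideal[OF s(1)]] by blast
  then show False
    using assms cgenideal_self[OF s(1)] by blast
qed

text \<open>Splitting off as many factors \<open>a\<close> as possible leaves a cofactor outside the
  only maximal ideal, that is, a unit. Hypothesis \<open>n\<close> bounds the number of
  factors.\<close>

lemma (in cring) power_times_unit_decomposition:
  assumes loc: "{J. maximalideal J R} = {PIdl a}" and a: "a \<in> carrier R"
    and s: "s \<in> carrier R" and n: "s \<notin> PIdl (a [^] (n::nat))"
  shows "\<exists>(k::nat) u. u \<in> Units R \<and> s = a [^] k \<otimes> u"
proof -
  \<comment> \<open>\<open>k\<close> is the first exponent whose power does not divide
    \<open>s\<close>. It is positive because \<one> divides \<open>s\<close>, so the exponent of the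
    factorization is its predecessor \<open>j\<close>.\<close>
  define k where "k = (LEAST n::nat. s \<notin> PIdl (a [^] n))"
  have k: "s \<notin> PIdl (a [^] k)" unfolding k_def by (rule LeastI[of _ n]) (rule n)
  have "s \<in> PIdl (a [^] (0::nat))"
    using s by (force simp: cgenideal_def)
  then have "k \<noteq> 0" using k by metis
  then obtain j where j: "k = Suc j" by (cases k) auto
  then have "s \<in> PIdl (a [^] j)"
    using not_less_Least[of j "\<lambda>n. s \<notin> PIdl (a [^] n)"] by (auto simp: k_def)
  then obtain t where t: "t \<in> carrier R" "s = t \<otimes> a [^] j"
    by (auto simp: cgenideal_def)
  have "t \<notin> PIdl a"
  proof
    assume "t \<in> PIdl a"
    then obtain r where r: "r \<in> carrier R" "t = r \<otimes> a" by (auto simp: cgenideal_def)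
    then have "s = r \<otimes> a [^] k"
      using t a by (simp add: j m_assoc m_comm[of a])
    then show False using k r by (auto simp: cgenideal_def)
  qed
  then have "t \<in> Units R"
    using mem_Units_of_unique_maximalideal[OF loc] t by blast
  moreover have "s = a [^] j \<otimes> t" using t a by (simp add: m_comm)
  ultimately show ?thesis by blast
qed

section \<open>Powers of ideals and of their elements\<close>

lemma (in ring) power_mem_ideal_power:
  assumes "p \<in> m" "ideal m R"
  shows "p [^] k \<in> m [^]\<^bsub>ideals_set R\<^esub> (k::nat)"
proof (induction k)
  case 0
  show ?case by (simp add: ideals_set_def)
next
  case (Suc k)
  have "p [^] k \<otimes> p \<in> (m [^]\<^bsub>ideals_set R\<^esub> k) \<cdot> m"
    using Suc assms by (intro ideal_prod.prod)
  then show ?case by (simp add: ideals_set_def)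
qed

text \<open>Separatedness speaks of ideal powers, the factorization of powers of one element. By
  this inclusion, an element outside the \<open>k\<close>-th power of \<open>m\<close> is not
  divisible by \<open>p [^] k\<close>.\<close>

lemma (in cring) cgenideal_subset_ideal_power:
  assumes "p \<in> m" "ideal m R"
  shows "PIdl (p [^] k) \<subseteq> m [^]\<^bsub>ideals_set R\<^esub> (k::nat)"
proof (rule cgenideal_minimal)
  interpret I: semiring "ideals_set R" by (rule ideals_set_is_semiring)
  have "m \<in> carrier (ideals_set R)" using assms by (simp add: ideals_set_def)
  then have "m [^]\<^bsub>ideals_set R\<^esub> k \<in> carrier (ideals_set R)" by simp
  then show "ideal (m [^]\<^bsub>ideals_set R\<^esub> k) R" by (simp add: ideals_set_def)
  show "p [^] k \<in> m [^]\<^bsub>ideals_set R\<^esub> k" using assms by (rule power_mem_ideal_power)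
qed

section \<open>Integral elements\<close>

text \<open>The coefficient list is consumed from its constant end. A zero constant term is removed
  by cancelling \<open>s\<close>; a nonzero one is a multiple of \<open>s\<close>, the cofactor
  being minus the value at \<open>s\<close> of the list without it.\<close>

lemma (in domain) root_divides_nonzero_constant:
  assumes S: "subring S R" and A: "A \<subseteq> S" and s: "s \<in> S" "s \<noteq> \<zero>"
    and q: "set q \<subseteq> A" "q \<noteq> []" "lead_coeff q \<noteq> \<zero>" "eval q s = \<zero>"
  shows "\<exists>r\<in>A - {\<zero>}. \<exists>t\<in>S. r = s \<otimes> t"
  using q
proof (induction q rule: rev_induct)
  case Nil
  then show ?case by simp
next
  case (snoc a q)
  have sub: "S \<subseteq> carrier R" using subringE(1)[OF S] .
  have aq: "a \<in> A" "set q \<subseteq> A" using snoc.prems by auto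
  have ev_S: "eval q s \<in> S"
    using ring.eval_in_carrier[OF subring_is_ring[OF S], of q s] eval_consistent[OF S] aq A s
    by auto
  have car: "a \<in> carrier R" "s \<in> carrier R" "eval q s \<in> carrier R" "set q \<subseteq> carrier R"
    using aq A s ev_S sub by auto
  have sum0: "eval q s \<otimes> s \<oplus> a = \<zero>"
    using snoc.prems eval_append_aux[of q a s] car by simp
  show ?case
  proof (cases "a = \<zero>")
    case True
    \<comment> \<open>Otherwise \<open>a\<close>, which is zero, would be the leading coefficient of
      the whole list.\<close>
    then have "q \<noteq> []" using snoc.prems by auto
    moreover have "eval q s = \<zero>"
      using sum0 True car s integral[of "eval q s" s] by auto
    ultimately show ?thesis using snoc aq by simp
  next
    case False
    have "a = s \<otimes> (\<ominus> eval q s)"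
      using sum0 car minus_equality[of a "eval q s \<otimes> s"] by (simp add: a_comm m_comm r_minus)
    then show ?thesis using False aq subringE(5)[OF S ev_S] by blast
  qed
qed

lemma (in ring) ring_hom_eval:
  assumes "g \<in> ring_hom R R" "set q \<subseteq> carrier R" "x \<in> carrier R" "\<And>a. a \<in> set q \<Longrightarrow> g a = a"
  shows "eval q (g x) = g (eval q x)"
proof -
  interpret h: ring_hom_ring R R g
    using assms(1) by (intro ring_hom_ringI2 ring_axioms)
  show ?thesis
    using assms(2-) by (induction q) (auto simp: eval_in_carrier h.hom_nat_pow)
qed

text \<open>Since \<open>g\<close> fixes the coefficients, a monic equation for \<open>x\<close> is
  also one for \<open>g x\<close>.\<close>

lemma (in ring) integral_closure_ring_hom:
  assumes "g \<in> ring_hom R R" "A \<subseteq> carrier R" "\<And>a. a \<in> A \<Longrightarrow> g a = a"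
    and x: "x \<in> integral_closure R A"
  shows "g x \<in> integral_closure R A"
proof -
  from x obtain p where p: "polynomial A p" "p \<noteq> []" "lead_coeff p = \<one>" "eval p x = \<zero>"
    and xR: "x \<in> carrier R"
    by (auto simp: integral_closure_def)
  have "set p \<subseteq> A" using p by (auto simp: polynomial_def)
  then have "eval p (g x) = g (eval p x)"
    using assms(2,3) xR by (intro ring_hom_eval[OF assms(1)]) auto
  then have "eval p (g x) = \<zero>"
    using p ring_hom_zero[OF assms(1)] ring_axioms by simp
  then show ?thesis
    using p ring_hom_closed[OF assms(1) xR] by (auto simp: integral_closure_def)
qed

text \<open>Each \<open>x\<close> in \<open>A\<close> is a root of the monic polynomial X -
  x.\<close>

lemma (in domain) subring_subset_integral_closure:
  assumes "subring A R"
  shows "A \<subseteq> integral_closure R A"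
proof
  fix x assume x: "x \<in> A"
  have xR: "x \<in> carrier R" using x subringE(1)[OF assms] by blast
  have "polynomial A [\<one>, \<ominus> x]"
    using subringE[OF assms] x by (simp add: polynomial_def)
  moreover have "eval [\<one>, \<ominus> x] x = \<zero>"
    using xR by (simp add: r_neg)
  ultimately show "x \<in> integral_closure R A"
    using xR by (force simp: integral_closure_def)
qed

section \<open>The group structure of the Galois group\<close>

text \<open>The group laws of \<open>galois_group\<close> are inherited from
  \<open>BijGroup\<close>. Its elements are extensional, so inverses carry a \<open>restrict\<close>
  and products are formed with \<open>compose\<close>.\<close>

lemma (in ring) subgroup_galois_group:
  assumes K: "K \<subseteq> carrier R"
  shows "subgroup (carrier (galois_group R K)) (BijGroup (carrier R))"
proof (rule group.subgroupI[OF group_BijGroup])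
  show "carrier (galois_group R K) \<subseteq> carrier (BijGroup (carrier R))"
    by (auto simp: galois_group_def BijGroup_def)
  have "(\<lambda>x\<in>carrier R. x) \<in> carrier (galois_group R K)"
    using K by (auto simp: galois_group_def id_Bij intro!: ring_hom_memI)
  then show "carrier (galois_group R K) \<noteq> {}" by blast
next
  fix h assume "h \<in> carrier (galois_group R K)"
  then have h: "h \<in> ring_hom R R" "h \<in> Bij (carrier R)" "\<And>x. x \<in> K \<Longrightarrow> h x = x"
    by (auto simp: galois_group_def)
  let ?g = "restrict (inv_into (carrier R) h) (carrier R)"
  have bij: "bij_betw h (carrier R) (carrier R)" using h(2) by (simp add: Bij_def)
  have "?g \<in> ring_hom R R"
  proof (rule ring_hom_memI)
    fix x y assume xy: "x \<in> carrier R" "y \<in> carrier R"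
    show "?g (x \<otimes> y) = ?g x \<otimes> ?g y" "?g (x \<oplus> y) = ?g x \<oplus> ?g y"
      using xy h ring_hom_mult[OF h(1)] ring_hom_add[OF h(1)]
      by (auto intro!: Bij_inv_into_lemma)
  next
    show "?g \<one> = \<one>"
      using bij_betw_inv_into_left[OF bij, of \<one>] ring_hom_one[OF h(1)] by simp
  qed (use h(2) in \<open>auto intro: Bij_inv_into_mem\<close>)
  moreover have "?g x = x" if "x \<in> K" for x
    using bij_betw_inv_into_left[OF bij, of x] h(3)[OF that] that K by auto
  ultimately show "inv\<^bsub>BijGroup (carrier R)\<^esub> h \<in> carrier (galois_group R K)"
    using restrict_inv_into_Bij[OF h(2)]
    by (simp add: inv_BijGroup[OF h(2)] galois_group_def del: restrict_apply)
next
  fix g h assume "g \<in> carrier (galois_group R K)" "h \<in> carrier (galois_group R K)"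
  then have g: "g \<in> ring_hom R R" "g \<in> Bij (carrier R)" "\<And>x. x \<in> K \<Longrightarrow> g x = x"
    and h: "h \<in> ring_hom R R" "h \<in> Bij (carrier R)" "\<And>x. x \<in> K \<Longrightarrow> h x = x"
    by (auto simp: galois_group_def)
  have "compose (carrier R) g h \<in> ring_hom R R"
    by (rule ring_hom_memI)
      (auto simp: compose_def ring_hom_closed[OF h(1)] ring_hom_closed[OF g(1)]
        ring_hom_mult[OF h(1)] ring_hom_mult[OF g(1)] ring_hom_add[OF h(1)] ring_hom_add[OF g(1)]
        ring_hom_one[OF h(1)] ring_hom_one[OF g(1)])
  then show "g \<otimes>\<^bsub>BijGroup (carrier R)\<^esub> h \<in> carrier (galois_group R K)"
    using g h K compose_Bij[OF g(2) h(2)]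
    by (auto simp: galois_group_def BijGroup_def compose_eq)
qed

lemma (in ring) group_galois_group:
  assumes "K \<subseteq> carrier R"
  shows "group (galois_group R K)"
  using subgroup.subgroup_is_group[OF subgroup_galois_group[OF assms] group_BijGroup]
  by (simp add: galois_group_def)

text \<open>A discrete valuation ring \<open>S\<close> in a field, with uniformizer \<open>\<pi>\<close>, presented by the
  factorization of its nonzero elements.\<close>

locale uniformized_subring = field L for L (structure) +
  fixes S \<pi>
  assumes subring_S: "subring S L"
    and unif_mem: "\<pi> \<in> S" and unif_nonzero: "\<pi> \<noteq> \<zero>"
    and unif_not_unit: "\<pi> \<notin> Units (L\<lparr>carrier := S\<rparr>)"
    and factor: "\<And>s. s \<in> S - {\<zero>} \<Longrightarrow> \<exists>(n::nat) u. u \<in> Units (L\<lparr>carrier := S\<rparr>) \<and> s = \<pi> [^] n \<otimes> u"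
begin

section \<open>Arithmetic of the valuation given by a uniformizer\<close>

abbreviation U where "U \<equiv> Units (L\<lparr>carrier := S\<rparr>)"
abbreviation val where "val \<equiv> adic_valuation L S \<pi>"

lemma S_closed [simp]: "x \<in> S \<Longrightarrow> x \<in> carrier L"
  using subringE(1)[OF subring_S] by blast

lemma S_mult: "x \<in> S \<Longrightarrow> y \<in> S \<Longrightarrow> x \<otimes> y \<in> S"
  by (rule subringE(6)[OF subring_S])

lemma S_pow: "x \<in> S \<Longrightarrow> x [^] (n::nat) \<in> S"
  by (induction n) (auto simp: S_mult subringE(3)[OF subring_S])

lemma U_S: "u \<in> U \<Longrightarrow> u \<in> S"
  by (simp add: Units_def)

lemma U_iff: "u \<in> U \<longleftrightarrow> u \<in> S \<and> (\<exists>v\<in>S. u \<otimes> v = \<one>)"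
  using S_closed m_comm by (fastforce simp: Units_def)

lemma U_mult: "u \<in> U \<Longrightarrow> v \<in> U \<Longrightarrow> u \<otimes> v \<in> U"
  using monoid.Units_m_closed[of "L\<lparr>carrier := S\<rparr>" u v] subring_is_ring[OF subring_S]
  by (simp add: ring.is_monoid)

lemma unif_pow_nonzero: "\<pi> [^] (n::nat) \<noteq> \<zero>"
proof (induction n)
  case (Suc n)
  then show ?case
    using integral[of "\<pi> [^] n" \<pi>] unif_mem unif_nonzero by auto
qed simp

lemma unif_not_dvd_unit:
  assumes "t \<in> S" "u \<in> U" shows "\<pi> \<otimes> t \<noteq> u"
proof
  assume *: "\<pi> \<otimes> t = u"
  obtain v where v: "v \<in> S" "u \<otimes> v = \<one>" using assms(2) U_iff by blast
  have "\<pi> \<otimes> (t \<otimes> v) = \<one>"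
    using * v assms unif_mem by (simp add: m_assoc[symmetric])
  then have "\<pi> \<in> U" unfolding U_iff using S_mult[OF assms(1) v(1)] unif_mem by blast
  then show False using unif_not_unit by contradiction
qed

text \<open>The exponent \<open>n\<close> is attained with cofactor \<open>u\<close>, and a larger
  one would make \<pi> divide the unit \<open>u\<close>. Negative exponents need no care, since only
  those above \<open>n\<close> have to be excluded.\<close>

lemma val_power_times_unit:
  assumes u: "u \<in> U"
  shows "val (\<pi> [^] (n::nat) \<otimes> u) = int n"
  unfolding adic_valuation_def
proof (rule Greatest_equality)
  show "\<pi> [^] n \<otimes> u \<in> {\<pi> [^] int n \<otimes> t |t. t \<in> S}"
    using U_S[OF u] by (auto simp: int_pow_int)
next
  fix z :: int
  assume "\<pi> [^] n \<otimes> u \<in> {\<pi> [^] z \<otimes> t |t. t \<in> S}"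
  then obtain t where t: "t \<in> S" "\<pi> [^] n \<otimes> u = \<pi> [^] z \<otimes> t" by blast
  show "z \<le> int n"
  proof (rule ccontr)
    assume "\<not> z \<le> int n"
    \<comment> \<open>The excess of \<open>z\<close> over \<open>n\<close> is written as a
      successor, so that one factor \<pi> can be split off after cancelling \<pi> to the power
      \<open>n\<close>.\<close>
    then have "z = int (n + Suc (nat (z - int n - 1)))" by simp
    then obtain j where z: "z = int (n + Suc j)" by blast
    have "\<pi> [^] n \<otimes> u = \<pi> [^] (n + Suc j) \<otimes> t"
      using t(2) unfolding z int_pow_int .
    also have "\<dots> = \<pi> [^] n \<otimes> (\<pi> [^] Suc j \<otimes> t)"
      using t unif_mem by (simp add: nat_pow_mult[symmetric] m_assoc del: nat_pow_Suc)
    finally have "u = \<pi> [^] Suc j \<otimes> t"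
      using m_lcancel[OF unif_pow_nonzero] t unif_mem U_S[OF u] by simp
    also have "\<dots> = \<pi> \<otimes> (\<pi> [^] j \<otimes> t)"
      using t unif_mem by (simp add: m_assoc m_comm[of _ \<pi>])
    finally show False
      using unif_not_dvd_unit[OF _ u] S_mult[OF S_pow[OF unif_mem] t(1)] by metis
  qed
qed

lemma val_mult:
  assumes "x \<in> S - {\<zero>}" "y \<in> S - {\<zero>}"
  shows "val (x \<otimes> y) = val x + val y"
proof -
  obtain n u where x: "u \<in> U" "x = \<pi> [^] (n::nat) \<otimes> u" using factor[OF assms(1)] by blast
  obtain m v where y: "v \<in> U" "y = \<pi> [^] (m::nat) \<otimes> v" using factor[OF assms(2)] by blast
  have "x \<otimes> y = \<pi> [^] (n + m) \<otimes> (u \<otimes> v)"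
    using x y unif_mem U_S
    by (simp add: nat_pow_mult[symmetric] m_assoc m_lcomm)
  then show ?thesis using x y U_mult val_power_times_unit by simp
qed

lemma val_nonneg: "x \<in> S - {\<zero>} \<Longrightarrow> 0 \<le> val x"
  using factor[of x] val_power_times_unit by fastforce

lemma val_eq_0_iff:
  assumes "x \<in> S - {\<zero>}"
  shows "val x = 0 \<longleftrightarrow> x \<in> U"
proof
  assume "val x = 0"
  moreover obtain n u where x: "u \<in> U" "x = \<pi> [^] (n::nat) \<otimes> u" using factor[OF assms] by blast
  ultimately have "x = u" using val_power_times_unit U_S by simp
  then show "x \<in> U" using x by simp
next
  assume "x \<in> U"
  then show "val x = 0" using val_power_times_unit[of x 0] U_S by simp
qed

text \<open>Units go to units and \<pi> goes to an associate, so the exponent of \<pi> in the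
  factorization of \<open>x\<close> is unchanged. This yields the Galois invariance of the
  valuation.\<close>

lemma val_ring_hom:
  assumes g: "g \<in> ring_hom L L" "\<And>s. s \<in> S \<Longrightarrow> g s \<in> S"
    and w: "w \<in> U" "g \<pi> = \<pi> \<otimes> w" and x: "x \<in> S - {\<zero>}"
  shows "val (g x) = val x"
proof -
  interpret h: ring_hom_ring L L g
    using g(1) by (intro ring_hom_ringI2 ring_axioms)
  obtain n u where x: "u \<in> U" "x = \<pi> [^] (n::nat) \<otimes> u" using factor[OF x] by blast
  obtain v where v: "v \<in> S" "u \<otimes> v = \<one>" using x(1) U_iff by blast
  have "g u \<otimes> g v = \<one>" using v U_S[OF x(1)] h.hom_mult[of u v] by simp
  then have gu: "g u \<in> U" unfolding U_iff using g(2) v U_S[OF x(1)] by blast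
  have wn: "w [^] n \<in> U"
    by (induction n) (use w U_mult U_iff subringE(3)[OF subring_S] in auto)
  have "g x = (g \<pi>) [^] n \<otimes> g u"
    using x unif_mem U_S by (simp add: h.hom_nat_pow)
  also have "\<dots> = \<pi> [^] n \<otimes> (w [^] n \<otimes> g u)"
    using w(2) unif_mem U_S[OF w(1)] U_S[OF gu] by (simp add: nat_pow_distrib m_assoc)
  finally show ?thesis
    using val_power_times_unit U_mult[OF wn gu] x by simp
qed

end

section \<open>The integral closure as a ring with uniformizer\<close>

text \<open>By \<open>unram\<close> and \<open>loc\<close>, the extension of \<open>m\<close> to
  \<open>S\<close> is generated by \<pi>, so \<pi> is associated to a generator \<open>p\<close> of
  \<open>m\<close>. The second conclusion records this because \<open>p\<close>, lying in
  \<open>A\<close>, is fixed by the Galois group.\<close>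

lemma (in field) uniformized_integral_closure:
  fixes A S m \<pi>
  assumes A: "subring A R"
    and dvr: "discrete_valuation_ring (R\<lparr>carrier := A\<rparr>)"
    and m: "maximalideal m (R\<lparr>carrier := A\<rparr>)"
    and sep: "(\<Inter>k::nat. m [^]\<^bsub>ideals_set (R\<lparr>carrier := A\<rparr>)\<^esub> k) = {\<zero>}"
    and S: "S = integral_closure R A"
    and unram: "maximalideal (Idl\<^bsub>R\<lparr>carrier := S\<rparr>\<^esub> m) (R\<lparr>carrier := S\<rparr>)"
    and \<pi>: "\<pi> \<in> S"
    and loc: "{J. maximalideal J (R\<lparr>carrier := S\<rparr>)} = {PIdl\<^bsub>R\<lparr>carrier := S\<rparr>\<^esub> \<pi>}"
  shows "uniformized_subring R S \<pi>"
    and "\<exists>p\<in>A. \<exists>c\<in>Units (R\<lparr>carrier := S\<rparr>). \<pi> = p \<otimes> c"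
proof -
  let ?A = "R\<lparr>carrier := A\<rparr>" and ?S = "R\<lparr>carrier := S\<rparr>"
  have max\<pi>: "maximalideal (PIdl\<^bsub>?S\<^esub> \<pi>) ?S" using loc by blast
  have S_car: "S \<subseteq> carrier R" unfolding S by (auto simp: integral_closure_def)
  have "ring ?S" using maximalideal.axioms(1)[OF max\<pi>] by (simp add: ideal_def)
  then have subS: "subring S R" by (rule ring_incl_imp_subring[OF S_car])
  have AS: "A \<subseteq> S" unfolding S by (rule subring_subset_integral_closure[OF A])
  interpret A: principal_domain ?A using dvr by (simp add: discrete_valuation_ring_def)
  interpret S: domain ?S by (rule subring_is_domain[OF subS])
  have m_ideal: "ideal m ?A" using m by (simp add: maximalideal_def)
  have locA: "{J. maximalideal J ?A} = {m}"
    using dvr m by (auto simp: discrete_valuation_ring_def)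
  obtain p where p: "p \<in> A" "m = PIdl\<^bsub>?A\<^esub> p" using A.exists_gen[OF m_ideal] by auto
  have pm: "p \<in> m" using A.cgenideal_self[of p] p by simp
  have mA: "m \<subseteq> A" using p A subringE(6)[OF A] by (auto simp: cgenideal_def)
  \<comment> \<open>A zero generator would make the zero ideal maximal and \<open>A\<close> a
    field.\<close>
  have "p \<noteq> \<zero>"
  proof
    assume "p = \<zero>"
    then have "m = {\<zero>}"
      using p A.cgenideal_eq_genideal[of p] A.genideal_zero by simp
    then have "field ?A" using m A.zeromaximalideal_fieldI by simp
    then show False using dvr by (simp add: discrete_valuation_ring_def)
  qed
  have pS: "p \<in> S" using p AS by blast
  have Idl: "Idl\<^bsub>?S\<^esub> m = PIdl\<^bsub>?S\<^esub> \<pi>" using unram loc by blast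
  have "m \<subseteq> Idl\<^bsub>?S\<^esub> m" using mA AS by (intro S.genideal_self) auto
  then obtain d where d: "d \<in> S" "p = d \<otimes> \<pi>"
    using pm Idl by (auto simp: cgenideal_def)
  have "m \<subseteq> PIdl\<^bsub>?S\<^esub> p"
    using p AS by (auto simp: cgenideal_def)
  then have "Idl\<^bsub>?S\<^esub> m \<subseteq> PIdl\<^bsub>?S\<^esub> p"
    using pS by (intro S.genideal_minimal S.cgenideal_ideal) auto
  then obtain c where c: "c \<in> S" "\<pi> = c \<otimes> p"
    using Idl S.cgenideal_self[of \<pi>] \<pi> by (auto simp: cgenideal_def)
  have car: "p \<in> carrier R" "c \<in> carrier R" "d \<in> carrier R" "\<pi> \<in> carrier R"
    using pS c(1) d(1) \<pi> S_car by auto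
  \<comment> \<open>Both \<open>p\<close> and \<pi> generate the same ideal of \<open>S\<close>;
    cancelling \<open>p\<close> shows that the quotients \<open>d\<close> and \<open>c\<close> are
    mutually inverse.\<close>
  have "(d \<otimes> c) \<otimes> p = \<one> \<otimes> p"
    using car c(2) d(2) by (metis l_one m_assoc)
  then have dc: "d \<otimes> c = \<one>"
    using car \<open>p \<noteq> \<zero>\<close> m_rcancel[of p "d \<otimes> c" \<one>] by simp
  then have cU: "c \<in> Units ?S"
    using c(1) d(1) dc m_comm[OF car(2,3)] by (auto simp: Units_def)
  then show "\<exists>p\<in>A. \<exists>c\<in>Units ?S. \<pi> = p \<otimes> c"
    using p(1) c(2) car m_comm by blast
  have not_unit: "\<pi> \<notin> Units ?S"
  proof
    assume "\<pi> \<in> Units ?S"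
    then have "\<one> \<in> PIdl\<^bsub>?S\<^esub> \<pi>" by (force simp: Units_def cgenideal_def)
    then show False
      using max\<pi> ideal.one_imp_carrier[of "PIdl\<^bsub>?S\<^esub> \<pi>" ?S] maximalideal.I_notcarr[OF max\<pi>]
      by (simp add: maximalideal_def)
  qed
  \<comment> \<open>If all powers of \<pi> divided \<open>s\<close>, they would divide the nonzero
    multiple \<open>a\<close> of \<open>s\<close> in \<open>A\<close>. But \<open>a\<close> is a
    unit \<open>w\<close> times some power of \<open>p\<close>, and \<open>p\<close> is associated
    to \<pi>.\<close>
  have not_all: "\<exists>n. s \<notin> PIdl\<^bsub>?S\<^esub> (\<pi> [^] (n::nat))" if s: "s \<in> S" "s \<noteq> \<zero>" for s
  proof (rule ccontr)
    assume all: "\<not> ?thesis"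
    obtain q where "polynomial A q" "q \<noteq> []" "lead_coeff q = \<one>" "eval q s = \<zero>"
      using s S by (auto simp: integral_closure_def)
    then obtain a t where a: "a \<in> A" "a \<noteq> \<zero>" and t: "t \<in> S" "a = s \<otimes> t"
      using root_divides_nonzero_constant[OF subS AS s, of q] by (auto simp: polynomial_def)
    obtain j where "a \<notin> m [^]\<^bsub>ideals_set ?A\<^esub> (j::nat)"
      using sep a by blast
    then have "a \<notin> PIdl\<^bsub>?A\<^esub> (p [^]\<^bsub>?A\<^esub> j)"
      using A.cgenideal_subset_ideal_power[OF pm m_ideal] by blast
    then obtain k w where w: "w \<in> Units ?A" "a = p [^] (k::nat) \<otimes> w"
      using A.power_times_unit_decomposition[of p a j] locA p a
      by (auto simp: nat_pow_consistent[symmetric])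
    \<comment> \<open>The exponent is one more than that of \<open>p\<close> in \<open>a\<close>, so
      that a factor \<pi> survives the cancellation of \<open>p [^] k\<close> and divides
      \<open>w\<close>.\<close>
    obtain r where r: "r \<in> S" "s = r \<otimes> \<pi> [^] Suc k"
      using all[simplified, rule_format, of "Suc k"] by (auto simp: cgenideal_def)
    have wA: "w \<in> A" using w by (simp add: Units_def)
    obtain w' where w': "w' \<in> A" "w \<otimes> w' = \<one>" using w by (auto simp: Units_def)
    have car': "r \<in> carrier R" "t \<in> carrier R" "w \<in> carrier R" "w' \<in> carrier R"
      "p [^] k \<in> carrier R" "c [^] k \<in> carrier R"
      using r t wA w' AS S_car car by auto
    have "\<pi> [^] Suc k = p [^] k \<otimes> (c [^] k \<otimes> \<pi>)"
      using c(2) car nat_pow_distrib[of c p k] by (simp add: m_ac)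
    then have s_eq: "s = r \<otimes> (p [^] k \<otimes> (c [^] k \<otimes> \<pi>))"
      using r(2) by simp
    have "p [^] k \<otimes> w = p [^] k \<otimes> (r \<otimes> (c [^] k \<otimes> \<pi>) \<otimes> t)"
      using car car' unfolding w(2)[symmetric] t(2) s_eq by (simp add: m_ac)
    moreover have "p [^] k \<noteq> \<zero>"
      using \<open>p \<noteq> \<zero>\<close> car by (induction k) (auto dest: integral)
    ultimately have weq: "w = r \<otimes> (c [^] k \<otimes> \<pi>) \<otimes> t"
      using m_lcancel car car' by simp
    have ckS: "c [^] k \<in> S"
      using c(1) by (induction k) (auto simp: subringE(3,6)[OF subS])
    \<comment> \<open>The cofactor of \<pi> in \<open>w\<close>, times the inverse \<open>w'\<close>
      of \<open>w\<close>: an inverse of \<pi> in \<open>S\<close>.\<close>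
    let ?e = "r \<otimes> c [^] k \<otimes> t \<otimes> w'"
    have "?e \<in> S"
      using subringE(6)[OF subS] r t w' AS ckS by blast
    moreover have "\<pi> \<otimes> ?e = \<one>"
      using w'(2) weq car car' by (simp add: m_ac)
    ultimately have "\<pi> \<in> Units ?S"
      using \<pi> car S_car m_comm by (fastforce simp: Units_def)
    then show False using not_unit by contradiction
  qed
  show "uniformized_subring R S \<pi>"
  proof (intro uniformized_subring.intro uniformized_subring_axioms.intro)
    show "field R" by (rule field_axioms)
    show "subring S R" "\<pi> \<in> S" "\<pi> \<notin> Units ?S" by fact+
    show "\<pi> \<noteq> \<zero>" using \<open>p \<noteq> \<zero>\<close> d(2) car by auto
    fix s assume "s \<in> S - {\<zero>}"
    then show "\<exists>(n::nat) u. u \<in> Units ?S \<and> s = \<pi> [^] n \<otimes> u"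
      using not_all[of s] S.power_times_unit_decomposition[OF loc, of s] \<pi>
      by (auto simp: nat_pow_consistent[symmetric])
  qed
qed

section \<open>Invariance of the valuation and the cocycle inequalities\<close>

theorem proposition4p2:
  fixes L :: "('a, 'b) ring_scheme"
    and R K S m :: "'a set"
    and \<pi> :: 'a
    and G :: "('a \<Rightarrow> 'a) monoid"
    and f :: "('a \<Rightarrow> 'a) \<Rightarrow> ('a \<Rightarrow> 'a) \<Rightarrow> 'a"
  assumes "field L"
    and "subring R L"
    and "discrete_valuation_ring (L\<lparr>carrier := R\<rparr>)"
    and "maximalideal m (L\<lparr>carrier := R\<rparr>)"
    and "adically_complete (L\<lparr>carrier := R\<rparr>) m"
    and "finite (carrier ((L\<lparr>carrier := R\<rparr>) Quot m))"
    and "quotient_field_in L R K"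
    and "finite_galois_extension L K"
    and "G = galois_group L K"
    and "S = integral_closure L R"
    and "unramified (L\<lparr>carrier := S\<rparr>) R m"
    and "\<pi> \<in> S"
    and "{J. maximalideal J (L\<lparr>carrier := S\<rparr>)} = {PIdl\<^bsub>L\<lparr>carrier := S\<rparr>\<^esub> \<pi>}"
    and "f \<in> weak_cocycles L S G"
  shows "(\<forall>\<sigma>\<in>carrier G. int (cocycle_val L S G \<pi> f \<sigma>) = adic_valuation L S \<pi> (f \<sigma> (inv\<^bsub>G\<^esub> \<sigma>)))
       \<and> cocycle_val L S G \<pi> f \<in> Sl G
       \<and> Sl_kernel G (cocycle_val L S G \<pi> f) = inertial_group L S G f"
proof -
  interpret L: field L by fact
  have R_car: "R \<subseteq> carrier L" using subringE(1)[OF assms(2)] .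
  have K: "K \<subseteq> carrier L" and RK: "R \<subseteq> K"
  proof -
    show "K \<subseteq> carrier L"
      using assms(7) unfolding quotient_field_in_def by (metis subfieldE(3))
    show "R \<subseteq> K"
    proof
      fix a assume a: "a \<in> R"
      then have "a = a \<otimes>\<^bsub>L\<^esub> inv\<^bsub>L\<^esub> \<one>\<^bsub>L\<^esub>" using R_car by auto
      then show "a \<in> K"
        using a subringE(3)[OF assms(2)] L.one_not_zero assms(7)
        unfolding quotient_field_in_def by blast
    qed
  qed
  interpret G: group G unfolding assms(9) by (rule L.group_galois_group[OF K])
  \<comment> \<open>Separatedness is part of \<open>adically_complete\<close>, and maximality of the
    extended ideal is part of \<open>unramified\<close>.\<close>
  have uni: "uniformized_subring L S \<pi>" "\<exists>p\<in>R. \<exists>c\<in>Units (L\<lparr>carrier := S\<rparr>). \<pi> = p \<otimes>\<^bsub>L\<^esub> c"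
    using L.uniformized_integral_closure[OF assms(2,3,4) _ assms(10) _ assms(12,13)] assms(5,11)
    by (auto simp: adically_complete_def unramified_def)
  interpret V: uniformized_subring L S \<pi> by (rule uni(1))
  obtain p c where p: "p \<in> R" and c: "c \<in> V.U" and \<pi>: "\<pi> = p \<otimes>\<^bsub>L\<^esub> c" using uni(2) by blast
  have hom: "\<sigma> \<in> ring_hom L L" and fix_R: "\<And>a. a \<in> R \<Longrightarrow> \<sigma> a = a" if "\<sigma> \<in> carrier G" for \<sigma>
    using that RK by (auto simp: assms(9) galois_group_def)
  have stable: "\<sigma> s \<in> S" if "\<sigma> \<in> carrier G" "s \<in> S" for \<sigma> s
    using L.integral_closure_ring_hom[OF hom[OF that(1)] R_car fix_R[OF that(1)]] that(2) assms(10)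
    by simp
  \<comment> \<open>As \<sigma> fixes \<open>p\<close>, the quotient of
    \<open>\<sigma> \<pi>\<close> by \<pi> equals that of \<open>\<sigma> c\<close> by
    \<open>c\<close>, which is a unit of \<open>S\<close>.\<close>
  have val_\<sigma>: "V.val (\<sigma> s) = V.val s" if \<sigma>: "\<sigma> \<in> carrier G" and s: "s \<in> S - {\<zero>\<^bsub>L\<^esub>}" for \<sigma> s
  proof -
    obtain c' where c': "c' \<in> S" "c \<otimes>\<^bsub>L\<^esub> c' = \<one>\<^bsub>L\<^esub>" using c V.U_iff by blast
    have car: "p \<in> carrier L" "c \<in> carrier L" "c' \<in> carrier L" "\<sigma> c \<in> carrier L"
      using p R_car c c' V.U_S stable[OF \<sigma>] by auto
    have "\<sigma> c \<otimes>\<^bsub>L\<^esub> \<sigma> c' = \<one>\<^bsub>L\<^esub>"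
      using ring_hom_mult[OF hom[OF \<sigma>], of c c'] ring_hom_one[OF hom[OF \<sigma>]] car c'(2) by simp
    then have "\<sigma> c \<in> V.U"
      unfolding V.U_iff using stable[OF \<sigma>] c'(1) V.U_S[OF c] by blast
    moreover have "c' \<in> V.U"
      unfolding V.U_iff using c' V.U_S[OF c] car L.m_comm by metis
    ultimately have "c' \<otimes>\<^bsub>L\<^esub> \<sigma> c \<in> V.U" by (rule V.U_mult[rotated])
    moreover have "\<sigma> \<pi> = \<pi> \<otimes>\<^bsub>L\<^esub> (c' \<otimes>\<^bsub>L\<^esub> \<sigma> c)"
    proof -
      have "\<pi> \<otimes>\<^bsub>L\<^esub> (c' \<otimes>\<^bsub>L\<^esub> \<sigma> c) = p \<otimes>\<^bsub>L\<^esub> ((c \<otimes>\<^bsub>L\<^esub> c') \<otimes>\<^bsub>L\<^esub> \<sigma> c)"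
        unfolding \<pi> using car by (simp add: L.m_assoc)
      also have "\<dots> = p \<otimes>\<^bsub>L\<^esub> \<sigma> c" using car c' by simp
      finally show ?thesis
        unfolding \<pi> using ring_hom_mult[OF hom[OF \<sigma>] car(1,2)] fix_R[OF \<sigma> p] by simp
    qed
    ultimately show ?thesis
      using V.val_ring_hom[OF hom[OF \<sigma>] stable[OF \<sigma>]] s by blast
  qed
  have f_S: "f \<sigma> \<tau> \<in> S - {\<zero>\<^bsub>L\<^esub>}" if "\<sigma> \<in> carrier G" "\<tau> \<in> carrier G" for \<sigma> \<tau>
    using assms(14) that by (auto simp: weak_cocycles_def)
  have f_one: "f \<one>\<^bsub>G\<^esub> \<sigma> = \<one>\<^bsub>L\<^esub>" if "\<sigma> \<in> carrier G" for \<sigma>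
    using assms(14) that by (auto simp: weak_cocycles_def)
  \<comment> \<open>Additivity of the valuation is available for nonzero elements only; injectivity
    of \<sigma> keeps the twisted cocycle values nonzero.\<close>
  have \<sigma>_f_S: "\<sigma> s \<in> S - {\<zero>\<^bsub>L\<^esub>}" if "\<sigma> \<in> carrier G" "s \<in> S - {\<zero>\<^bsub>L\<^esub>}" for \<sigma> s
  proof -
    have "\<sigma> \<in> Bij (carrier L)" using that(1) by (simp add: assms(9) galois_group_def)
    then have "inj_on \<sigma> (carrier L)" by (simp add: Bij_def bij_betw_def)
    moreover have "\<sigma> \<zero>\<^bsub>L\<^esub> = \<zero>\<^bsub>L\<^esub>"
      using ring_hom_zero[OF hom[OF that(1)]] L.ring_axioms by blast
    ultimately have "\<sigma> s \<noteq> \<zero>\<^bsub>L\<^esub>"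
      using inj_onD[of \<sigma> "carrier L" s "\<zero>\<^bsub>L\<^esub>"] that(2) by auto
    then show ?thesis using stable that by blast
  qed
  \<comment> \<open>Invariance of the valuation removes the twist by \<sigma> from the cocycle
    identity.\<close>
  have val_cocycle: "V.val (f \<sigma> \<tau>) + V.val (f (\<sigma> \<otimes>\<^bsub>G\<^esub> \<tau>) \<rho>) = V.val (f \<tau> \<rho>) + V.val (f \<sigma> (\<tau> \<otimes>\<^bsub>G\<^esub> \<rho>))"
    if "\<sigma> \<in> carrier G" "\<tau> \<in> carrier G" "\<rho> \<in> carrier G" for \<sigma> \<tau> \<rho>
  proof -
    have "f \<sigma> \<tau> \<otimes>\<^bsub>L\<^esub> f (\<sigma> \<otimes>\<^bsub>G\<^esub> \<tau>) \<rho> = \<sigma> (f \<tau> \<rho>) \<otimes>\<^bsub>L\<^esub> f \<sigma> (\<tau> \<otimes>\<^bsub>G\<^esub> \<rho>)"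
      using assms(14) that by (auto simp: weak_cocycles_def)
    then have "V.val (f \<sigma> \<tau> \<otimes>\<^bsub>L\<^esub> f (\<sigma> \<otimes>\<^bsub>G\<^esub> \<tau>) \<rho>) = V.val (\<sigma> (f \<tau> \<rho>) \<otimes>\<^bsub>L\<^esub> f \<sigma> (\<tau> \<otimes>\<^bsub>G\<^esub> \<rho>))"
      by simp
    then show ?thesis
      using that f_S \<sigma>_f_S by (simp only: V.val_mult val_\<sigma> G.m_closed)
  qed
  \<comment> \<open>The value \<open>f \<one> \<one>\<close> shows that \<one> is a nonzero element
    of \<open>S\<close>, so its valuation equals twice itself by additivity.\<close>
  have val_one: "V.val \<one>\<^bsub>L\<^esub> = 0"
    using V.val_eq_0_iff[of "\<one>\<^bsub>L\<^esub>"] f_S[of "\<one>\<^bsub>G\<^esub>" "\<one>\<^bsub>G\<^esub>"] f_one V.val_mult[of "\<one>\<^bsub>L\<^esub>" "\<one>\<^bsub>L\<^esub>"] by simp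
  \<comment> \<open>The truncation by \<open>nat\<close> is harmless because cocycle values lie in
    \<open>S\<close>, where the valuation is nonnegative.\<close>
  have r: "int (cocycle_val L S G \<pi> f \<sigma>) = V.val (f \<sigma> (inv\<^bsub>G\<^esub> \<sigma>))" if "\<sigma> \<in> carrier G" for \<sigma>
    using V.val_nonneg[OF f_S] that by (simp add: cocycle_val_def)
  have subadd: "cocycle_val L S G \<pi> f (\<sigma> \<otimes>\<^bsub>G\<^esub> \<tau>) \<le> cocycle_val L S G \<pi> f \<sigma> + cocycle_val L S G \<pi> f \<tau>"
    if \<sigma>: "\<sigma> \<in> carrier G" and \<tau>: "\<tau> \<in> carrier G" for \<sigma> \<tau>
  proof -
    let ?\<rho> = "inv\<^bsub>G\<^esub> (\<sigma> \<otimes>\<^bsub>G\<^esub> \<tau>)"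
    have \<rho>: "?\<rho> = inv\<^bsub>G\<^esub> \<tau> \<otimes>\<^bsub>G\<^esub> inv\<^bsub>G\<^esub> \<sigma>" using \<sigma> \<tau> by (simp add: G.inv_mult_group)
    then have \<tau>\<rho>: "\<tau> \<otimes>\<^bsub>G\<^esub> ?\<rho> = inv\<^bsub>G\<^esub> \<sigma>" using \<sigma> \<tau> by (simp add: G.m_assoc[symmetric])
    have "V.val (f \<sigma> \<tau>) + V.val (f (\<sigma> \<otimes>\<^bsub>G\<^esub> \<tau>) ?\<rho>) = V.val (f \<tau> ?\<rho>) + V.val (f \<sigma> (inv\<^bsub>G\<^esub> \<sigma>))"
      using val_cocycle[OF \<sigma> \<tau>, of ?\<rho>] \<sigma> \<tau> \<tau>\<rho> by simp
    \<comment> \<open>The second term on the left of this cocycle identity is the valuation of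
      \<open>f \<one> (inv \<sigma>)\<close>, which is zero by normalization.\<close>
    moreover have "V.val (f \<tau> (inv\<^bsub>G\<^esub> \<tau>)) = V.val (f (inv\<^bsub>G\<^esub> \<tau>) (inv\<^bsub>G\<^esub> \<sigma>)) + V.val (f \<tau> ?\<rho>)"
      using val_cocycle[OF \<tau>, of "inv\<^bsub>G\<^esub> \<tau>" "inv\<^bsub>G\<^esub> \<sigma>"] \<sigma> \<tau> by (simp add: \<rho> f_one val_one)
    \<comment> \<open>Dropping these two terms turns the equalities into the required upper
      bounds.\<close>
    moreover have "0 \<le> V.val (f \<sigma> \<tau>)" "0 \<le> V.val (f (inv\<^bsub>G\<^esub> \<tau>) (inv\<^bsub>G\<^esub> \<sigma>))"
      using \<sigma> \<tau> by (auto intro!: V.val_nonneg f_S)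
    ultimately show ?thesis using r[OF \<sigma>] r[OF \<tau>] r[OF G.m_closed[OF \<sigma> \<tau>]] by linarith
  qed
  have "cocycle_val L S G \<pi> f \<one>\<^bsub>G\<^esub> = 0"
    using r[of "\<one>\<^bsub>G\<^esub>"] f_one val_one by simp
  then have "cocycle_val L S G \<pi> f \<in> Sl G"
    using subadd by (simp add: Sl_def)
  moreover have "cocycle_val L S G \<pi> f \<sigma> = 0 \<longleftrightarrow> f \<sigma> (inv\<^bsub>G\<^esub> \<sigma>) \<in> V.U" if "\<sigma> \<in> carrier G" for \<sigma>
    using r[OF that] V.val_eq_0_iff[OF f_S[OF that G.inv_closed[OF that]]]
    by (metis of_nat_eq_0_iff)
  ultimately show ?thesis
    using r by (auto simp: Sl_kernel_def inertial_group_def)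
qed

end
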